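(* Let $p$ be a prime, $n\ge 2$ and $t\ge 1$ integers, and $\mathcal{D}$ the Desarguesian $(t-1)$-spread of $\mathrm{PG}(nt-1,p)$. Let $\Sigma$ be a $\mathcal{D}_{n-2}$-subspace (an $(nt-t-1)$-dimensional subspace spanned by elements of $\mathcal{D}$), let $\Sigma'$ be an $(nt-t)$-dimensional subspace containing $\Sigma$, let $Y\in\mathcal{D}$ with $Y\subseteq\Sigma$, let $\Omega$ be a hyperplane of $Y$, let $\Gamma'$ be an $(nt-2t+1)$-dimensional subspace of $\Sigma'$ disjoint from $\Omega$, let $\Gamma=\Gamma'\cap\Sigma$ and let $T$ be the point $\Gamma\cap Y$. Let $\bar{B}$ be a blocking set with respect to the hyperplanes of $\Gamma'$ such that $\bar{B}\cap\Gamma$ is a single point and such that for every line $\ell$ of $\Gamma'$ through $T$ we have $\ell\setminus\{T\}\not\subseteq\bar{B}$, and let $K$ be the cone with vertex $\Omega$ and base $\bar{B}$. If $B=\mathcal{B}(K)$ is a small minimal blocking set with respect to the hyperplanes of $\mathrm{PG}(n-1,p^t)$, then $B$ is $\mathbb{F}_p$-linear and of R\'edei-type.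
   Context: Field reduction: each point of $\mathrm{PG}(n-1,p^t)$ corresponds to a $(t-1)$-dimensional subspace of $\mathrm{PG}(nt-1,p)$ (the $1$-dimensional $\mathbb{F}_{p^t}$-subspace viewed over $\mathbb{F}_p$); these form the Desarguesian $(t-1)$-spread $\mathcal{D}$, and a $\mathcal{D}_{r-1}$-subspace is an $(rt-1)$-dimensional subspace spanned by elements of $\mathcal{D}$. For $U\subseteq\mathrm{PG}(nt-1,p)$, $\mathcal{B}(U)$ is the set of elements of $\mathcal{D}$ meeting $U$, identified with points of $\mathrm{PG}(n-1,p^t)$. The cone with vertex $\Omega$ and base $\bar B$ is $\bigcup_{P\in\bar B}\langle P,\Omega\rangle$. A blocking set (with respect to hyperplanes) meets every hyperplane; minimal means no proper subset does; small means fewer than $3(p^t+1)/2$ points. $B$ is $\mathbb{F}_p$-linear if $B=\mathcal{B}(\mu)$ for some subspace $\mu$ of $\mathrm{PG}(nt-1,p)$. $B$ is of R\'edei-type if some hyperplane meets $B$ in exactly $|B|-p^t$ points. *)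

theory Defs
  imports Main "HOL-Library.Cardinality" "HOL-Computational_Algebra.Primes"
begin

text \<open>
Model. Let q = p^t and let 'a be a finite field with CARD('a) = q, and 'n a finite index
type with CARD('n) = n. The ambient space is V = 'a^n, realised as functions 'n => 'a.
Via field reduction, PG(n-1,q) is the lattice of 'a-subspaces of V and PG(nt-1,p) is the
lattice of F_p-subspaces of V, where F_p is the prime subfield {of_nat k}.
Projective subspaces are represented by their underlying vector subspaces; projective
dimension d corresponds to cardinality p^(d+1) (resp. q^(d+1)).
Point sets are sets of projective points (subspaces of cardinality p).
\<close>

definition vzero :: "'n \<Rightarrow> 'a::zero" where
  "vzero = (\<lambda>_. 0)"

definition vadd :: "('n \<Rightarrow> 'a::plus) \<Rightarrow> ('n \<Rightarrow> 'a) \<Rightarrow> ('n \<Rightarrow> 'a)" where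
  "vadd x y = (\<lambda>i. x i + y i)"

definition smul :: "'a::times \<Rightarrow> ('n \<Rightarrow> 'a) \<Rightarrow> ('n \<Rightarrow> 'a)" where
  "smul c x = (\<lambda>i. c * x i)"

definition Fp_subspace :: "('n \<Rightarrow> 'a::field) set \<Rightarrow> bool" where
  "Fp_subspace U \<longleftrightarrow> vzero \<in> U \<and> (\<forall>x\<in>U. \<forall>y\<in>U. vadd x y \<in> U)
     \<and> (\<forall>k::nat. \<forall>x\<in>U. smul (of_nat k) x \<in> U)"

definition Fq_subspace :: "('n \<Rightarrow> 'a::field) set \<Rightarrow> bool" where
  "Fq_subspace U \<longleftrightarrow> vzero \<in> U \<and> (\<forall>x\<in>U. \<forall>y\<in>U. vadd x y \<in> U)
     \<and> (\<forall>c. \<forall>x\<in>U. smul c x \<in> U)"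

definition Fp_point :: "nat \<Rightarrow> ('n \<Rightarrow> 'a::field) set \<Rightarrow> bool" where
  "Fp_point p P \<longleftrightarrow> Fp_subspace P \<and> card P = p"

text \<open>Elements of the Desarguesian spread D = points of PG(n-1,q).\<close>
definition spread_elt :: "('n \<Rightarrow> 'a::{field,finite}) set \<Rightarrow> bool" where
  "spread_elt X \<longleftrightarrow> Fq_subspace X \<and> card X = CARD('a)"

definition Fq_hyperplane :: "('n::finite \<Rightarrow> 'a::{field,finite}) set \<Rightarrow> bool" where
  "Fq_hyperplane H \<longleftrightarrow> Fq_subspace H \<and> card H = CARD('a) ^ (CARD('n) - 1)"

definition pts :: "nat \<Rightarrow> ('n \<Rightarrow> 'a::field) set \<Rightarrow> ('n \<Rightarrow> 'a) set set" where
  "pts p U = {P. Fp_point p P \<and> P \<subseteq> U}"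

definition calB :: "('n \<Rightarrow> 'a::{field,finite}) set set \<Rightarrow> ('n \<Rightarrow> 'a) set set" where
  "calB U = {X. spread_elt X \<and> (\<exists>Q\<in>U. Q \<subseteq> X)}"

definition sumset :: "('n \<Rightarrow> 'a::plus) set \<Rightarrow> ('n \<Rightarrow> 'a) set \<Rightarrow> ('n \<Rightarrow> 'a) set" where
  "sumset A B = {vadd a b | a b. a \<in> A \<and> b \<in> B}"

definition cone :: "nat \<Rightarrow> ('n \<Rightarrow> 'a::field) set \<Rightarrow> ('n \<Rightarrow> 'a) set set \<Rightarrow> ('n \<Rightarrow> 'a) set set" where
  "cone p Om Bb = {Q. Fp_point p Q \<and> (\<exists>P\<in>Bb. Q \<subseteq> sumset P Om)}"

definition Fp_blocking_in :: "nat \<Rightarrow> ('n \<Rightarrow> 'a::field) set \<Rightarrow> ('n \<Rightarrow> 'a) set set \<Rightarrow> bool" where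
  "Fp_blocking_in p G Bb \<longleftrightarrow> (\<forall>P\<in>Bb. Fp_point p P \<and> P \<subseteq> G)
     \<and> (\<forall>H. Fp_subspace H \<and> H \<subseteq> G \<and> card H * p = card G \<longrightarrow> (\<exists>P\<in>Bb. P \<subseteq> H))"

definition blocking :: "('n::finite \<Rightarrow> 'a::{field,finite}) set set \<Rightarrow> bool" where
  "blocking B \<longleftrightarrow> (\<forall>X\<in>B. spread_elt X) \<and> (\<forall>H. Fq_hyperplane H \<longrightarrow> (\<exists>X\<in>B. X \<subseteq> H))"

definition minimal_blocking :: "('n::finite \<Rightarrow> 'a::{field,finite}) set set \<Rightarrow> bool" where
  "minimal_blocking B \<longleftrightarrow> blocking B \<and> (\<forall>B'. B' \<subset> B \<longrightarrow> \<not> blocking B')"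

definition small :: "('n::finite \<Rightarrow> 'a::{field,finite}) set set \<Rightarrow> bool" where
  "small B \<longleftrightarrow> 2 * card B < 3 * (CARD('a) + 1)"

definition Fp_linear :: "nat \<Rightarrow> ('n::finite \<Rightarrow> 'a::{field,finite}) set set \<Rightarrow> bool" where
  "Fp_linear p B \<longleftrightarrow> (\<exists>mu. Fp_subspace mu \<and> B = calB (pts p mu))"

definition Redei_type :: "('n::finite \<Rightarrow> 'a::{field,finite}) set set \<Rightarrow> bool" where
  "Redei_type B \<longleftrightarrow> (\<exists>H. Fq_hyperplane H \<and> card {X\<in>B. X \<subseteq> H} + CARD('a) = card B)"

end

theory Submission
  imports Defs "HOL-Computational_Algebra.Polynomial" "HOL-Number_Theory.Cong" "HOL-Library.Function_Algebras"
begin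

text \<open>Let \<open>P\<close> be the only point of \<open>Bb\<close> in \<open>Sig\<close> and \<open>N\<close> the number of the others. Each of these
  contributes \<open>p ^ (t - 1)\<close> spread elements outside \<open>Sig\<close>, so smallness gives \<open>2 * N \<le> 3 * p\<close>. As
  \<open>p\<close> is prime, Blokhuis' lacunary polynomial argument, with the hyperplane at infinity being one
  that meets \<open>Bb\<close> in \<open>P\<close> only, shows that \<open>Bb\<close> contains a line \<open>L\<close> through \<open>P\<close>. The subspace \<open>mu\<close>
  spanned by \<open>L\<close> and \<open>Om\<close> has vector space dimension \<open>t + 1\<close>, so it meets every hyperplane of
  \<open>PG(n - 1, p ^ t)\<close> and by minimality its linear set is the whole of \<open>calB (cone p Om Bb)\<close>. Since
  \<open>mu\<close> meets \<open>Sig\<close> in dimension \<open>t\<close>, exactly \<open>p ^ t\<close> elements lie outside \<open>Sig\<close>.\<close>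

subsection \<open>The prime subfield\<close>

text \<open>The image of the naturals matches the scalars \<open>of_nat k\<close> in
  \<open>Fp_subspace\<close>. In positive characteristic it is already closed under negation and
  inversion.\<close>

definition prime_subfield :: "'a::field set" where
  "prime_subfield = range of_nat"

lemma prime_CHAR_finite: "prime CHAR('a::{field,finite})"
  by (rule prime_CHAR_semidom) (simp add: finite_imp_CHAR_pos)

text \<open>Translation by 1 permutes the field, so summing all elements before and after shows that
  \<open>of_nat CARD('a)\<close> is 0. The characteristic is thus a prime divisor of
  \<open>p ^ t\<close>.\<close>

lemma CHAR_eq_of_card:
  assumes "prime p" "CARD('a::{field,finite}) = p ^ t"
  shows "CHAR('a) = p"
proof -
  have "(\<Sum>x\<in>UNIV. x + 1) = (\<Sum>x\<in>UNIV. x :: 'a)"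
    by (rule sum.reindex_bij_betw) (rule bij_betw_byWitness[where f' = "\<lambda>x. x - 1"], auto)
  then have "of_nat CARD('a) = (0 :: 'a)"
    by (simp add: sum.distrib)
  then have "CHAR('a) dvd p ^ t"
    by (metis assms(2) of_nat_eq_0_iff_char_dvd)
  then show ?thesis
    using assms(1) prime_CHAR_finite[where ?'a = 'a] prime_dvd_power primes_dvd_imp_eq by metis
qed

lemma
  shows zero_prime_subfield [simp]: "0 \<in> (prime_subfield :: 'a::field set)"
    and one_prime_subfield [simp]: "1 \<in> (prime_subfield :: 'a::field set)"
    and of_nat_prime_subfield [simp]: "of_nat k \<in> (prime_subfield :: 'a::field set)"
proof -
  have of_nat: "of_nat k \<in> (prime_subfield :: 'a set)" for k
    by (simp add: prime_subfield_def)
  then show "of_nat k \<in> (prime_subfield :: 'a set)" .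
  from of_nat[of 0] of_nat[of 1] show "0 \<in> (prime_subfield :: 'a set)" "1 \<in> (prime_subfield :: 'a set)"
    by simp_all
qed

lemma add_prime_subfield: "x \<in> prime_subfield \<Longrightarrow> y \<in> prime_subfield \<Longrightarrow> x + y \<in> prime_subfield"
  unfolding prime_subfield_def by (auto simp flip: of_nat_add)

lemma mult_prime_subfield: "x \<in> prime_subfield \<Longrightarrow> y \<in> prime_subfield \<Longrightarrow> x * y \<in> prime_subfield"
  unfolding prime_subfield_def by (auto simp flip: of_nat_mult)

lemma power_prime_subfield: "x \<in> prime_subfield \<Longrightarrow> x ^ k \<in> prime_subfield"
  by (induction k) (auto intro: mult_prime_subfield)

lemma uminus_prime_subfield:
  fixes x :: "'a::{field,finite}"
  assumes "x \<in> prime_subfield"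
  shows "- x \<in> prime_subfield"
proof -
  have "CHAR('a) > 0"
    by (simp add: finite_imp_CHAR_pos)
  then have "(of_nat (CHAR('a) - 1) :: 'a) = -1"
    by (simp add: of_nat_diff)
  then have "- x = of_nat (CHAR('a) - 1) * x"
    by simp
  then show ?thesis
    using assms mult_prime_subfield of_nat_prime_subfield by metis
qed

lemma diff_prime_subfield:
  fixes x y :: "'a::{field,finite}"
  shows "x \<in> prime_subfield \<Longrightarrow> y \<in> prime_subfield \<Longrightarrow> x - y \<in> prime_subfield"
  using add_prime_subfield[of x "- y"] uminus_prime_subfield[of y] by simp

lemma bij_betw_prime_subfield:
  "bij_betw of_nat {..<CHAR('a)} (prime_subfield :: 'a::{field,finite} set)"
proof (rule bij_betwI')
  fix i j assume "i \<in> {..<CHAR('a)}" "j \<in> {..<CHAR('a)}"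
  then show "((of_nat i :: 'a) = of_nat j) = (i = j)"
    by (auto simp: of_nat_eq_iff_cong_CHAR cong_def)
next
  fix y :: 'a assume "y \<in> prime_subfield"
  then obtain k where k: "y = of_nat k"
    by (auto simp: prime_subfield_def)
  have "CHAR('a) > 0"
    by (simp add: finite_imp_CHAR_pos)
  moreover have "y = of_nat (k mod CHAR('a))"
    unfolding k by (subst of_nat_eq_iff_cong_CHAR) (simp add: cong_def)
  ultimately show "\<exists>i\<in>{..<CHAR('a)}. y = of_nat i"
    by (intro bexI[of _ "k mod CHAR('a)"]) auto
qed auto

lemma card_prime_subfield: "card (prime_subfield :: 'a::{field,finite} set) = CHAR('a)"
  using bij_betw_same_card[OF bij_betw_prime_subfield[where ?'a = 'a]] by simp

text \<open>Fermat's little theorem: raising to the power \<open>CHAR('a)\<close> is additive and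
  fixes 0 and 1, hence every \<open>of_nat k\<close>.\<close>

lemma prime_subfield_power_CHAR:
  fixes x :: "'a::{field,finite}"
  assumes "x \<in> prime_subfield"
  shows "x ^ CHAR('a) = x"
proof -
  obtain k where k: "x = of_nat k"
    using assms by (auto simp: prime_subfield_def)
  have "(of_nat k :: 'a) ^ CHAR('a) = of_nat k"
    by (induction k) (auto simp: freshmans_dream prime_CHAR_finite finite_imp_CHAR_pos zero_power)
  then show ?thesis by (simp add: k)
qed

lemma inverse_prime_subfield:
  fixes x :: "'a::{field,finite}"
  assumes "x \<in> prime_subfield"
  shows "inverse x \<in> prime_subfield"
proof (cases "x = 0")
  case False
  have "CHAR('a) \<ge> 2"
    using prime_CHAR_finite prime_ge_2_nat by blast
  \<comment> \<open>By Fermat the inverse of a nonzero \<open>x\<close> is its power with exponent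
    \<open>CHAR('a) - 2\<close>, which stays in the subfield.\<close>
  then obtain k where k: "CHAR('a) = Suc (Suc k)"
    by (metis add_2_eq_Suc le_Suc_ex)
  then have "x ^ k * x * x = x ^ CHAR('a)"
    by (simp add: mult_ac)
  also have "\<dots> = x"
    by (rule prime_subfield_power_CHAR) fact
  finally have "x ^ k = inverse x"
    using False by (simp add: inverse_eq_divide eq_divide_eq)
  then show ?thesis
    using power_prime_subfield[OF assms, of k] by simp
qed auto

text \<open>Frobenius is additive with trivial kernel, so it is injective and, on a finite field,
  surjective. This supplies the root that turns \<open>T ^ p + c\<close> into a \<open>p\<close>-th
  power.\<close>

lemma surj_power_CHAR: "surj (\<lambda>x::'a::{field,finite}. x ^ CHAR('a))"
proof (rule finite_UNIV_inj_surj)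
  show "inj (\<lambda>x::'a. x ^ CHAR('a))"
  proof (rule injI)
    fix x y :: 'a assume "x ^ CHAR('a) = y ^ CHAR('a)"
    moreover have "((x - y) + y) ^ CHAR('a) = (x - y) ^ CHAR('a) + y ^ CHAR('a)"
      by (rule freshmans_dream) (auto simp: prime_CHAR_finite)
    ultimately have "(x - y) ^ CHAR('a) = 0" by simp
    then show "x = y" by simp
  qed
qed auto

subsection \<open>Redei polynomials\<close>

text \<open>The witness \<open>s\<close> is the coefficient of \<open>T ^ k\<close> in the Redei polynomial
  \<open>\<Prod>v. T + U * X v - Y v\<close>, read as a polynomial in \<open>U\<close>.\<close>

lemma redei_coefficients:
  fixes X Y :: "'b \<Rightarrow> 'a::field"
  assumes "finite S" "k \<le> card S"
  shows "\<exists>s. degree s \<le> card S - k \<and> coeff s (card S - k) = coeff (\<Prod>v\<in>S. [:X v, 1:]) k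
           \<and> (\<forall>u. poly s u = coeff (\<Prod>v\<in>S. [:u * X v - Y v, 1:]) k)"
  using assms
proof (induction S arbitrary: k rule: finite_induct)
  case empty
  then show ?case by (intro exI[of _ 1]) auto
next
  case (insert w S)
  let ?n = "card S"
  have "\<exists>s. degree s \<le> Suc ?n - k \<and> coeff s (Suc ?n - k) = X w * coeff (\<Prod>v\<in>S. [:X v, 1:]) k
           \<and> (\<forall>u. poly s u = (u * X w - Y w) * coeff (\<Prod>v\<in>S. [:u * X v - Y v, 1:]) k)"
  proof (cases "k \<le> ?n")
    case True
    then obtain s where s: "degree s \<le> ?n - k" "coeff s (?n - k) = coeff (\<Prod>v\<in>S. [:X v, 1:]) k"
      "\<And>u. poly s u = coeff (\<Prod>v\<in>S. [:u * X v - Y v, 1:]) k"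
      using insert.IH[OF True] by auto
    have "degree ([:- Y w, X w:] * s) \<le> 1 + (?n - k)"
      by (rule order.trans[OF degree_mult_le]) (use s(1) in auto)
    moreover have "coeff ([:- Y w, X w:] * s) (Suc (?n - k)) = X w * coeff s (?n - k)"
      using s(1) by (simp add: coeff_eq_0)
    ultimately show ?thesis
      using s True by (intro exI[of _ "[:- Y w, X w:] * s"]) (auto simp: Suc_diff_le algebra_simps)
  next
    case False
    have "degree (\<Prod>v\<in>S. [:f v, 1:]) = ?n" for f :: "'b \<Rightarrow> 'a"
      by (subst degree_prod_eq_sum_degree) auto
    then have "coeff (\<Prod>v\<in>S. [:f v, 1:]) k = 0" for f :: "'b \<Rightarrow> 'a"
      using False by (simp add: coeff_eq_0)
    then show ?thesis by (intro exI[of _ 0]) auto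
  qed
  then obtain s where s: "degree s \<le> Suc ?n - k"
      "coeff s (Suc ?n - k) = X w * coeff (\<Prod>v\<in>S. [:X v, 1:]) k"
      "\<And>u. poly s u = (u * X w - Y w) * coeff (\<Prod>v\<in>S. [:u * X v - Y v, 1:]) k"
    by auto
  show ?case
  proof (cases k)
    case 0
    then show ?thesis using s insert.hyps by (intro exI[of _ s]) simp
  next
    case (Suc j)
    then have "j \<le> ?n"
      using insert.prems insert.hyps by simp
    from insert.IH[OF this] obtain r where r: "degree r \<le> ?n - j"
        "coeff r (?n - j) = coeff (\<Prod>v\<in>S. [:X v, 1:]) j"
        "\<And>u. poly r u = coeff (\<Prod>v\<in>S. [:u * X v - Y v, 1:]) j"
      by auto
    show ?thesis
      using s r insert.hyps Suc by (intro exI[of _ "s + r"]) (auto intro: degree_add_le)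
  qed
qed

text \<open>For \<open>u\<close> in the prime subfield, surjectivity makes the Redei polynomial
  divisible by \<open>T ^ p - T\<close> with a monic cofactor of degree \<open>m\<close>, so its
  coefficient at \<open>T ^ e\<close> does not depend on \<open>u\<close>. As a polynomial in
  \<open>U\<close> this coefficient has degree at most \<open>p + m - e < p\<close> and agrees with
  a constant at \<open>p\<close> values, hence is constant. The claimed coefficient stands at the
  positive power \<open>U ^ (p + m - e)\<close>.\<close>

lemma redei_lacunary:
  fixes X Y :: "'b \<Rightarrow> 'a::{field,finite}"
  defines "p \<equiv> CHAR('a)"
  assumes fin: "finite S" and card: "card S = p + m"
    and surj: "\<And>u b. u \<in> prime_subfield \<Longrightarrow> b \<in> prime_subfield \<Longrightarrow> \<exists>v\<in>S. Y v - u * X v = b"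
    and e: "m < e" "e < p"
  shows "coeff (\<Prod>v\<in>S. [:X v, 1:]) e = 0"
proof -
  have p2: "p \<ge> 2"
    unfolding p_def using prime_CHAR_finite prime_ge_2_nat by blast
  have key: "coeff (\<Prod>v\<in>S. [:u * X v - Y v, 1:]) e = (if e = Suc m then - 1 else 0)"
    if u: "u \<in> prime_subfield" for u :: 'a
  proof -
    define P where "P = (\<Prod>v\<in>S. [:u * X v - Y v, 1:])"
    define Q :: "'a poly" where "Q = monom 1 p - monom 1 1"
    define G where "G = P div Q"
    have degP: "degree P = p + m"
      unfolding P_def using card by (subst degree_prod_eq_sum_degree) auto
    have lcP: "lead_coeff P = 1"
      unfolding P_def by (simp add: lead_coeff_prod)
    have "coeff Q p = 1" "degree Q \<le> p"
      unfolding Q_def using p2 by (auto intro!: degree_diff_le degree_monom_le order.trans[OF degree_monom_le])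
    then have degQ: "degree Q = p" and lcQ: "lead_coeff Q = 1" and Q0: "Q \<noteq> 0"
      using le_degree[of Q p] by auto
    \<comment> \<open>Both \<open>T ^ p - T\<close> and \<open>P\<close> vanish on the whole prime
      subfield, so the remainder has \<open>p\<close> roots but degree below
      \<open>p\<close>.\<close>
    have "P mod Q = 0"
    proof (rule poly_eqI_degree[where A = prime_subfield])
      fix b :: 'a assume b: "b \<in> prime_subfield"
      then obtain v where v: "v \<in> S" "Y v - u * X v = b"
        using surj u by blast
      have "poly P b = 0"
        unfolding P_def poly_prod using fin v by (intro prod_zero bexI[of _ v]) auto
      moreover have "poly Q b = 0"
        using prime_subfield_power_CHAR[OF b] by (simp add: Q_def p_def poly_monom)
      moreover have "P mod Q = P - P div Q * Q"
        by (simp add: minus_div_mult_eq_mod)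
      ultimately show "poly (P mod Q) b = poly 0 b" by simp
    next
      show "degree (P mod Q) < card (prime_subfield :: 'a set)"
        using degree_mod_less[OF Q0, of P] p2 by (auto simp: card_prime_subfield degQ simp flip: p_def)
    qed (use p2 in \<open>auto simp: card_prime_subfield p_def\<close>)
    then have PGQ: "P = Q * G"
      unfolding G_def by (simp add: mod_eq_0_iff_dvd)
    have "G \<noteq> 0"
      using PGQ lcP by auto
    then have "degree G = m"
      using PGQ degP degQ Q0 by (simp add: degree_mult_eq)
    moreover have "lead_coeff G = 1"
      using lcP lcQ by (simp add: PGQ lead_coeff_mult)
    \<comment> \<open>Since \<open>e - 1 \<ge> m\<close>, only the leading coefficient of
      \<open>G\<close> can be met.\<close>
    ultimately have "coeff G (e - 1) = (if e = Suc m then 1 else 0)"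
      using e by (auto simp: coeff_eq_0)
    moreover have "coeff P e = - coeff G (e - 1)"
      using e by (simp add: PGQ Q_def left_diff_distrib coeff_monom_mult)
    ultimately show ?thesis by (simp add: P_def)
  qed
  obtain s where s: "degree s \<le> card S - e" "coeff s (card S - e) = coeff (\<Prod>v\<in>S. [:X v, 1:]) e"
      "\<And>u. poly s u = coeff (\<Prod>v\<in>S. [:u * X v - Y v, 1:]) e"
    using redei_coefficients[OF fin, of e X Y] e card by auto
  have "s = [:if e = Suc m then - 1 else 0:]"
  proof (rule poly_eqI_degree[where A = prime_subfield])
    fix u :: 'a assume "u \<in> prime_subfield"
    then show "poly s u = poly [:if e = Suc m then - 1 else 0:] u"
      using key s(3) by simp
  qed (use s(1) e card p2 in \<open>auto simp: card_prime_subfield simp flip: p_def\<close>)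
  moreover have "card S - e > 0"
    using e card by simp
  ultimately show ?thesis
    using s(2) by (cases "card S - e") auto
qed

section \<open>Degree bounds and the Wronskian in positive characteristic\<close>

lemma CHAR_poly: "CHAR('a::comm_ring_1 poly) = CHAR('a)"
  by (rule CHAR_eqI) (auto simp: of_nat_poly of_nat_eq_0_iff_char_dvd)

text \<open>Upper bounds on the degrees suffice, which allows for derivatives whose degree drops
  further in characteristic \<open>p\<close>.\<close>

lemma coeff_mult_top:
  assumes "degree p \<le> m" "degree q \<le> n"
  shows "coeff (p * q) (m + n) = coeff p m * coeff q n"
proof (cases "degree p = m \<and> degree q = n")
  case True
  then show ?thesis using coeff_mult_degree_sum by blast
next
  case False
  then have "degree p + degree q < m + n" using assms by auto
  then have "degree (p * q) < m + n" using degree_mult_le[of p q] by linarith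
  then show ?thesis using False assms by (auto simp: coeff_eq_0)
qed

lemma degree_pderiv_le: "degree p \<le> n \<Longrightarrow> degree (pderiv p) \<le> n - 1"
  by (rule degree_le) (auto simp: coeff_pderiv coeff_eq_0)

lemma pderiv_degree_0: "degree p = 0 \<Longrightarrow> pderiv p = 0"
  by (auto elim: degree_eq_zeroE)

text \<open>Subtracting a multiple of \<open>g\<close> removes the coefficient of \<open>h\<close>
  at \<open>T ^ m\<close> and keeps the Wronskian zero. If a nonzero \<open>k\<close> of degree
  \<open>j < m\<close> remained, comparing coefficients at \<open>T ^ (j + m - 1)\<close> would give
  \<open>m = j\<close> in the field, impossible for \<open>j < m < CHAR('a)\<close>.\<close>

lemma wronskian_zero_imp_smult:
  fixes g h :: "'a::{field,finite} poly"
  assumes g: "lead_coeff g = 1" and deg: "degree h \<le> degree g" and small: "degree g < CHAR('a)"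
    and W: "pderiv h * g = h * pderiv g"
  shows "h = smult (coeff h (degree g)) g"
proof (rule ccontr)
  define m where "m = degree g"
  define k where "k = h - smult (coeff h m) g"
  assume "h \<noteq> smult (coeff h (degree g)) g"
  then have k0: "k \<noteq> 0" by (simp add: k_def m_def)
  have "coeff k m = 0" "degree k \<le> m"
    using g deg by (auto simp: k_def m_def intro: degree_diff_le order.trans[OF degree_smult_le])
  then have "degree k < m"
    using k0 by (metis leading_coeff_0_iff le_neq_implies_less)
  define j where "j = degree k"
  have jm: "j < m" unfolding j_def by fact
  have "pderiv k * g = k * pderiv g"
    using W by (simp add: k_def pderiv_diff pderiv_smult algebra_simps)
  then have eq: "coeff (pderiv k * g) (j + m - 1) = coeff (k * pderiv g) (j + m - 1)" by simp
  have "coeff (k * pderiv g) (j + (m - 1)) = coeff k j * coeff (pderiv g) (m - 1)"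
    by (rule coeff_mult_top) (auto simp: j_def m_def intro: order.trans[OF degree_pderiv_le[OF order.refl]])
  then have "coeff (k * pderiv g) (j + m - 1) = coeff k j * of_nat m"
    using jm g by (simp add: coeff_pderiv m_def)
  moreover have "coeff (pderiv k * g) (j + m - 1) = coeff k j * of_nat j"
  proof (cases j)
    case 0
    then have "pderiv k = 0" by (simp add: j_def pderiv_degree_0)
    then show ?thesis using 0 by simp
  next
    case (Suc i)
    have "coeff (pderiv k * g) (i + m) = coeff (pderiv k) i * coeff g m"
      by (rule coeff_mult_top) (use Suc in \<open>auto simp: j_def m_def intro: order.trans[OF degree_pderiv_le[OF order.refl]]\<close>)
    then show ?thesis using Suc g by (simp add: coeff_pderiv m_def)
  qed
  ultimately have "coeff k j * of_nat m = coeff k j * of_nat j"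
    using eq by metis
  then have "(of_nat m :: 'a) = of_nat j"
    using k0 by (simp add: j_def)
  then have "m mod CHAR('a) = j mod CHAR('a)"
    by (simp add: of_nat_eq_iff_cong_CHAR cong_def)
  moreover have "m < CHAR('a)" "j < CHAR('a)"
    using jm small by (simp_all add: m_def)
  ultimately show False using jm by simp
qed

text \<open>With \<open>f = \<Prod>v. T + X v = T ^ p * g + h\<close>, a factor \<open>(T - a) ^ e\<close> of \<open>f\<close> divides
  \<open>(T * g + h) * (h' * g - h * g')\<close>: the polynomial \<open>T * g + h = f - (T ^ p - T) * g\<close> vanishes
  at \<open>a\<close>, and \<open>h' * g - h * g' = f' * g - f * g'\<close>. Comparing degrees, the Wronskian vanishes.\<close>

lemma blokhuis_lacunary:
  fixes X :: "'b \<Rightarrow> 'a::{field,finite}"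
  defines "p \<equiv> CHAR('a)"
  assumes fin: "finite S" and card: "card S = p + m" and m: "2 * m \<le> p"
    and X: "\<And>v. v \<in> S \<Longrightarrow> X v \<in> prime_subfield"
    and lac: "\<And>e. m < e \<Longrightarrow> e < p \<Longrightarrow> coeff (\<Prod>v\<in>S. [:X v, 1:]) e = 0"
  shows "\<exists>c. p \<le> card {v\<in>S. X v = c}"
proof -
  have pr: "prime p" unfolding p_def by (rule prime_CHAR_finite)
  then have p2: "p \<ge> 2" by (rule prime_ge_2_nat)
  define f where "f = (\<Prod>v\<in>S. [:X v, 1:])"
  define g where "g = poly_shift p f"
  define h where "h = poly_cutoff p f"
  have degf: "degree f = p + m"
    unfolding f_def using card by (subst degree_prod_eq_sum_degree) auto
  have lcf: "coeff f (p + m) = 1"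
    using degf lead_coeff_prod[of "\<lambda>v. [:X v, 1:]" S] by (simp add: f_def)
  have f0: "f \<noteq> 0" using lcf by auto
  have f: "f = monom 1 p * g + h"
    by (auto simp: poly_eq_iff coeff_monom_mult g_def h_def coeff_poly_shift coeff_poly_cutoff)
  have "coeff g m = 1" "degree g \<le> m"
    using lcf degf by (auto simp: g_def coeff_poly_shift add.commute coeff_eq_0 intro!: degree_le)
  then have degg: "degree g = m" and lcg: "lead_coeff g = 1"
    using le_degree[of g m] by auto
  have g0: "g \<noteq> 0" using lcg by auto
  \<comment> \<open>The gap in the coefficients enters here: it lowers the bound on the degree of
    \<open>h\<close> from \<open>p - 1\<close> to \<open>m\<close>.\<close>
  have degh: "degree h \<le> m"
    using lac by (auto simp: h_def coeff_poly_cutoff f_def intro!: degree_le)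
  define L where "L = monom 1 1 * g + h"
  define W where "W = pderiv h * g - h * pderiv g"
  have "coeff L (Suc m) = 1" "degree L \<le> Suc m"
    using \<open>coeff g m = 1\<close> degh degg
    by (auto simp: L_def coeff_monom_mult coeff_eq_0 degree_monom_eq degree_mult_eq g0 intro!: degree_add_le)
  then have L0: "L \<noteq> 0" by auto
  \<comment> \<open>The derivative of \<open>T ^ p\<close> vanishes in characteristic
    \<open>p\<close>.\<close>
  have pd: "pderiv f = monom 1 p * pderiv g + pderiv h"
    by (simp add: f pderiv_add pderiv_mult pderiv_monom p_def)
  have W_alt: "W = pderiv f * g - f * pderiv g"
    by (simp add: W_def pd) (simp add: f algebra_simps)
  have proots_f: "proots f = image_mset (\<lambda>v. - X v) (mset_set S)"
    unfolding f_def using fin by (subst proots_prod) (auto simp: sum_unfold_sum_mset)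
  have W0: "W = 0"
  proof (rule ccontr)
    assume W0: "W \<noteq> 0"
    have "proots f \<subseteq># proots (L * W)"
    proof (rule mset_subset_eqI)
      fix a
      let ?e = "order a f"
      show "count (proots f) a \<le> count (proots (L * W)) a"
      proof (cases ?e)
        case 0
        then show ?thesis using f0 by simp
      next
        case (Suc e)
        have fa: "poly f a = 0" using Suc by (simp add: order_root)
        then obtain v where "v \<in> S" "a = - X v"
          using fin by (auto simp: f_def poly_prod eq_neg_iff_add_eq_0 add.commute)
        then have "a \<in> prime_subfield" using X uminus_prime_subfield by blast
        then have "poly L a = 0"
          using fa prime_subfield_power_CHAR[of a] by (simp add: f L_def poly_monom p_def)
        then have "order a L \<ge> 1" using L0 by (simp add: order_root)
        moreover have "order a W \<ge> e"
        proof -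
          obtain r where r: "f = [:- a, 1:] ^ Suc e * r"
            using order_1[of a f] Suc by (auto elim: dvdE)
          have "[:- a, 1:] ^ e dvd pderiv f"
            unfolding r pderiv_mult pderiv_power_Suc unfolding power_Suc
            by (rule dvd_add[OF dvd_mult2[OF dvd_mult[OF dvd_refl]] dvd_mult[OF dvd_mult2[OF dvd_smult[OF dvd_refl]]]])
          moreover have "[:- a, 1:] ^ e dvd f"
            unfolding r power_Suc by (rule dvd_mult2[OF dvd_mult[OF dvd_refl]])
          ultimately have "[:- a, 1:] ^ e dvd W"
            unfolding W_alt by (intro dvd_diff dvd_mult2)
          then show ?thesis using W0 by (simp add: order_divides)
        qed
        ultimately show ?thesis
          using L0 W0 f0 Suc by (simp add: order_mult)
      qed
    qed
    then have "size (proots f) \<le> size (proots (L * W))" by (rule size_mset_mono)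
    also have "\<dots> \<le> degree (L * W)" by (rule size_proots_le)
    also have "\<dots> = degree L + degree W" using L0 W0 by (rule degree_mult_eq)
    finally have le: "p + m \<le> degree L + degree W" by (simp add: proots_f card)
    \<comment> \<open>For \<open>m = 0\<close> both \<open>g\<close> and \<open>h\<close> are
      constant and the Wronskian is zero. Positivity also makes the subtractions below
      genuine.\<close>
    have "m > 0"
    proof (rule ccontr)
      assume "\<not> m > 0"
      then have "pderiv g = 0" "pderiv h = 0"
        using degg degh by (auto simp: pderiv_degree_0)
      then show False using W0 by (simp add: W_def)
    qed
    \<comment> \<open>At \<open>T ^ (2 * m - 1)\<close> both products contribute \<open>m\<close>
      times the coefficients of \<open>g\<close> and \<open>h\<close> at \<open>T ^ m\<close>, and
      these cancel. The degree saved is what settles the equality case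
      \<open>2 * m = p\<close>.\<close>
    have "degree W \<le> 2 * m - 2"
    proof (rule degree_le, intro allI impI)
      fix i assume i: "2 * m - 2 < i"
      show "coeff W i = 0"
      proof (cases "i = 2 * m - 1")
        case True
        have "coeff (pderiv h * g) ((m - 1) + m) = coeff (pderiv h) (m - 1) * coeff g m"
          using degh degg degree_pderiv_le[of h m] by (intro coeff_mult_top) auto
        moreover have "coeff (h * pderiv g) (m + (m - 1)) = coeff h m * coeff (pderiv g) (m - 1)"
          using degh degg degree_pderiv_le[of g m] by (intro coeff_mult_top) auto
        moreover have "m - 1 + m = i" "m + (m - 1) = i" using True \<open>m > 0\<close> by auto
        ultimately show ?thesis
          using \<open>m > 0\<close> by (simp add: W_def coeff_pderiv)
      next
        case False
        have "degree (pderiv h * g) \<le> 2 * m - 1"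
          using degh degg degree_pderiv_le[of h m] \<open>m > 0\<close>
          by (intro order.trans[OF degree_mult_le]) linarith
        moreover have "degree (h * pderiv g) \<le> 2 * m - 1"
          using degh degg degree_pderiv_le[of g m] \<open>m > 0\<close>
          by (intro order.trans[OF degree_mult_le]) linarith
        ultimately show ?thesis
          using i False by (simp add: W_def coeff_eq_0)
      qed
    qed
    \<comment> \<open>The count reads \<open>p + m \<le> (m + 1) + (2 * m - 2)\<close>, that is
      \<open>p \<le> 2 * m - 1\<close>.\<close>
    then show False
      using le \<open>degree L \<le> Suc m\<close> m \<open>m > 0\<close> by linarith
  qed
  define c where "c = coeff h m"
  have "h = smult c g"
    unfolding c_def using wronskian_zero_imp_smult[of g h] lcg degh degg m p2 W0
    by (simp add: W_def p_def)
  \<comment> \<open>Now \<open>f = (T ^ p + c) * g\<close>, and a \<open>p\<close>-th root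
    \<open>b\<close> of \<open>c\<close> makes the first factor \<open>(T + b) ^ p\<close>. So
    \<open>- b\<close> is a root of multiplicity at least \<open>p\<close>, and the roots of
    \<open>f\<close> are the \<open>- X v\<close>.\<close>
  obtain b where b: "b ^ p = c"
    using surj_power_CHAR[where ?'a = 'a] unfolding p_def by (metis surjE)
  have "[:b, 1:] ^ p = [:b:] ^ p + monom 1 1 ^ p"
  proof -
    have "[:b, 1:] = [:b:] + monom 1 1" by (simp add: monom_altdef)
    then show ?thesis using freshmans_dream[of p "[:b:]" "monom 1 1"] pr by (simp add: p_def CHAR_poly)
  qed
  then have "[:b, 1:] ^ p = [:c:] + monom 1 p"
    using b by (simp add: monom_power poly_const_pow)
  then have "f = [:b, 1:] ^ p * g"
    by (simp add: f \<open>h = smult c g\<close> algebra_simps)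
  then have "p \<le> order (- b) f"
    using f0 order_divides[of "- b" p f] by auto
  also have "\<dots> = count (proots f) (- b)" using f0 by simp
  also have "\<dots> = card {v\<in>S. X v = b}"
    unfolding proots_f count_image_mset card_eq_sum using fin by (intro sum.cong) auto
  finally show ?thesis by blast
qed

text \<open>In the affine plane over the prime subfield, \<open>surj\<close> says that
  \<open>S\<close> meets every non-vertical line. Writing \<open>card S = p + m\<close>, the size
  bound becomes \<open>2 * m \<le> p\<close>, so the two lacunary lemmas produce \<open>p\<close>
  points with one abscissa, which fill a vertical line.\<close>

lemma redei_line:
  fixes S :: "('a::{field,finite} \<times> 'a) set"
  defines "p \<equiv> CHAR('a)"
  assumes fin: "finite S" and card: "2 * card S \<le> 3 * p"
    and S: "S \<subseteq> prime_subfield \<times> prime_subfield"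
    and surj: "\<And>u b. u \<in> prime_subfield \<Longrightarrow> b \<in> prime_subfield \<Longrightarrow> \<exists>v\<in>S. snd v - u * fst v = b"
  shows "\<exists>c. {c} \<times> prime_subfield \<subseteq> S"
proof -
  have "prime_subfield \<subseteq> snd ` S"
    using surj[of 0] by force
  then have "p \<le> card S"
    using card_mono[of "snd ` S" "prime_subfield :: 'a set"] card_image_le[of S snd] fin
    by (simp add: card_prime_subfield p_def)
  then obtain m where m: "card S = p + m"
    using le_Suc_ex by blast
  have "\<exists>c. p \<le> card {v\<in>S. fst v = c}"
    unfolding p_def
  proof (rule blokhuis_lacunary[OF fin])
    show "card S = CHAR('a) + m" "2 * m \<le> CHAR('a)"
      using m card by (auto simp: p_def)
    fix e assume "m < e" "e < CHAR('a)"
    then show "coeff (\<Prod>v\<in>S. [:fst v, 1:]) e = 0"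
      using redei_lacunary[OF fin, of m snd fst] surj m by (simp add: p_def)
  qed (use S in auto)
  then obtain c where c: "p \<le> card {v\<in>S. fst v = c}" by blast
  have "{v\<in>S. fst v = c} = {c} \<times> prime_subfield"
  proof (rule card_seteq)
    show "{v\<in>S. fst v = c} \<subseteq> {c} \<times> prime_subfield" using S by auto
    show "card ({c} \<times> (prime_subfield :: 'a set)) \<le> card {v\<in>S. fst v = c}"
      using c by (simp add: card_cartesian_product card_prime_subfield p_def)
  qed simp
  then show ?thesis by blast
qed

subsection \<open>Subspaces and functionals over the prime subfield\<close>

lemma vadd_eq_plus: "vadd = (+)"
  by (simp add: vadd_def fun_eq_iff)

lemma vzero_eq_0: "vzero = 0"
  by (simp add: vzero_def fun_eq_iff)

lemma
  fixes x y :: "'n \<Rightarrow> 'a::field"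
  shows smul_add: "smul c (x + y) = smul c x + smul c y"
    and smul_add_left: "smul (a + b) x = smul a x + smul b x"
    and smul_diff_left: "smul (a - b) x = smul a x - smul b x"
    and smul_smul [simp]: "smul a (smul b x) = smul (a * b) x"
    and smul_one [simp]: "smul 1 x = x"
    and smul_zero_left [simp]: "smul 0 x = 0"
    and smul_zero_right [simp]: "smul c 0 = (0 :: 'n \<Rightarrow> 'a)"
    and smul_minus_one: "smul (- 1) x = - x"
  by (auto simp: smul_def fun_eq_iff algebra_simps)

lemma smul_eq_0_iff [simp]: "smul c x = 0 \<longleftrightarrow> c = 0 \<or> x = (0 :: 'n \<Rightarrow> 'a::field)"
  by (auto simp: smul_def fun_eq_iff)

lemma Fp_subspace_iff:
  "Fp_subspace U \<longleftrightarrow> 0 \<in> U \<and> (\<forall>x\<in>U. \<forall>y\<in>U. x + y \<in> U) \<and> (\<forall>c\<in>prime_subfield. \<forall>x\<in>U. smul c x \<in> U)"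
  by (auto simp: Fp_subspace_def prime_subfield_def vadd_eq_plus vzero_eq_0)

lemma Fq_subspace_iff:
  "Fq_subspace U \<longleftrightarrow> 0 \<in> U \<and> (\<forall>x\<in>U. \<forall>y\<in>U. x + y \<in> U) \<and> (\<forall>c. \<forall>x\<in>U. smul c x \<in> U)"
  by (auto simp: Fq_subspace_def vadd_eq_plus vzero_eq_0)

lemma sumset_eq: "sumset A B = {a + b | a b. a \<in> A \<and> b \<in> B}"
  by (simp add: sumset_def vadd_eq_plus)

lemma sumsetI: "a \<in> A \<Longrightarrow> b \<in> B \<Longrightarrow> a + b \<in> sumset A B"
  by (auto simp: sumset_eq)

lemma Fq_imp_Fp_subspace: "Fq_subspace U \<Longrightarrow> Fp_subspace U"
  by (auto simp: Fq_subspace_iff Fp_subspace_iff)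

lemma
  assumes "Fp_subspace (U :: ('n \<Rightarrow> 'a::{field,finite}) set)"
  shows Fp_subspace_0: "0 \<in> U"
    and Fp_subspace_add: "x \<in> U \<Longrightarrow> y \<in> U \<Longrightarrow> x + y \<in> U"
    and Fp_subspace_smul: "c \<in> prime_subfield \<Longrightarrow> x \<in> U \<Longrightarrow> smul c x \<in> U"
    and Fp_subspace_diff: "x \<in> U \<Longrightarrow> y \<in> U \<Longrightarrow> x - y \<in> U"
proof -
  show "0 \<in> U" and add: "\<And>x y. x \<in> U \<Longrightarrow> y \<in> U \<Longrightarrow> x + y \<in> U"
    and smul: "\<And>c x. c \<in> prime_subfield \<Longrightarrow> x \<in> U \<Longrightarrow> smul c x \<in> U"
    using assms by (auto simp: Fp_subspace_iff)
  assume "x \<in> U" "y \<in> U"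
  moreover have "x - y = x + smul (- 1) y" by (simp add: smul_minus_one)
  ultimately show "x - y \<in> U"
    using add smul uminus_prime_subfield[OF one_prime_subfield] by metis
qed

lemma Fp_subspace_smul_cancel:
  fixes U :: "('n \<Rightarrow> 'a::{field,finite}) set"
  assumes "Fp_subspace U" "c \<in> prime_subfield" "c \<noteq> 0" "smul c x \<in> U"
  shows "x \<in> U"
  using Fp_subspace_smul[OF assms(1) inverse_prime_subfield[OF assms(2)] assms(4)] assms(3) by simp

lemma Fp_subspace_sumset:
  assumes "Fp_subspace A" "Fp_subspace B"
  shows "Fp_subspace (sumset A B)"
  unfolding Fp_subspace_iff
proof (intro conjI ballI)
  show "0 \<in> sumset A B"
    using assms sumsetI[of 0 A 0 B] by (simp add: Fp_subspace_iff)
next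
  fix x y assume "x \<in> sumset A B" "y \<in> sumset A B"
  then obtain a b a' b' where "x = a + b" "y = a' + b'" "a \<in> A" "b \<in> B" "a' \<in> A" "b' \<in> B"
    by (auto simp: sumset_eq)
  then have "x + y = (a + a') + (b + b')" "a + a' \<in> A" "b + b' \<in> B"
    using assms by (auto simp: Fp_subspace_iff)
  then show "x + y \<in> sumset A B" using sumsetI by metis
next
  fix c :: 'b and x :: "'a \<Rightarrow> 'b" assume c: "c \<in> prime_subfield" "x \<in> sumset A B"
  then obtain a b where "x = a + b" "a \<in> A" "b \<in> B"
    by (auto simp: sumset_eq)
  then have "smul c x = smul c a + smul c b" "smul c a \<in> A" "smul c b \<in> B"
    using assms c by (auto simp: Fp_subspace_iff smul_add)
  then show "smul c x \<in> sumset A B" using sumsetI by metis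
qed

lemma sumset_superset:
  assumes "Fp_subspace A" "Fp_subspace B"
  shows "A \<subseteq> sumset A B" "B \<subseteq> sumset A B"
  using assms sumsetI[of _ A 0 B] sumsetI[of 0 A _ B] by (auto simp: Fp_subspace_iff)

lemma inj_on_sumset:
  fixes A B :: "('n \<Rightarrow> 'a::{field,finite}) set"
  assumes A: "Fp_subspace A" and B: "Fp_subspace B" and "A \<inter> B = {0}"
  shows "inj_on (\<lambda>(a, b). a + b) (A \<times> B)"
proof (rule inj_onI, clarsimp)
  fix a b a' b' assume *: "a \<in> A" "b \<in> B" "a' \<in> A" "b' \<in> B" "a + b = a' + b'"
  then have "a - a' = b' - b" by (simp add: algebra_simps)
  moreover have "a - a' \<in> A" "b' - b \<in> B"
    using * A B Fp_subspace_diff by blast+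
  ultimately have "b' - b \<in> A \<inter> B" by simp
  then have "b' - b = 0" using assms(3) by blast
  then show "a = a' \<and> b = b'" using \<open>a - a' = b' - b\<close> by simp
qed

lemma card_sumset:
  fixes A B :: "('n \<Rightarrow> 'a::{field,finite}) set"
  assumes "Fp_subspace A" "Fp_subspace B" "A \<inter> B = {0}"
  shows "card (sumset A B) = card A * card B"
proof -
  have "sumset A B = (\<lambda>(a, b). a + b) ` (A \<times> B)"
    by (auto simp: sumset_eq)
  then show ?thesis
    using card_image[OF inj_on_sumset[OF assms]] by (simp add: card_cartesian_product)
qed

section \<open>One-dimensional spans over the two fields\<close>

definition Fp_span :: "('n \<Rightarrow> 'a::field) \<Rightarrow> ('n \<Rightarrow> 'a) set" where
  "Fp_span v = (\<lambda>c. smul c v) ` prime_subfield"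

definition Fq_span :: "('n \<Rightarrow> 'a::field) \<Rightarrow> ('n \<Rightarrow> 'a) set" where
  "Fq_span v = range (\<lambda>c. smul c v)"

lemma inj_smul: "v \<noteq> 0 \<Longrightarrow> inj (\<lambda>c. smul c (v :: 'n \<Rightarrow> 'a::field))"
  using smul_diff_left[of _ _ v] by (intro injI) (metis eq_iff_diff_eq_0 smul_eq_0_iff)

lemma in_Fp_span [simp]: "v \<in> Fp_span v"
  using image_eqI[of v "\<lambda>c. smul c v" 1 prime_subfield] by (simp add: Fp_span_def)

lemma in_Fq_span [simp]: "v \<in> Fq_span v"
  using range_eqI[of v "\<lambda>c. smul c v" 1] by (simp add: Fq_span_def)

lemma Fp_subspace_span: "Fp_subspace (Fp_span v)"
  unfolding Fp_subspace_iff
proof (intro conjI ballI)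
  show "0 \<in> Fp_span v"
    using image_eqI[of 0 "\<lambda>c. smul c v" 0 prime_subfield] by (simp add: Fp_span_def)
qed (auto simp: Fp_span_def simp flip: smul_add_left intro!: add_prime_subfield mult_prime_subfield)

lemma Fq_subspace_span: "Fq_subspace (Fq_span v)"
  unfolding Fq_subspace_iff
proof (intro conjI ballI allI)
  show "0 \<in> Fq_span v"
    using range_eqI[of 0 "\<lambda>c. smul c v" 0] by (simp add: Fq_span_def)
qed (auto simp: Fq_span_def simp flip: smul_add_left)

lemma Fp_span_subset: "Fp_subspace U \<Longrightarrow> v \<in> U \<Longrightarrow> Fp_span v \<subseteq> U"
  by (auto simp: Fp_subspace_iff Fp_span_def)

lemma Fq_span_subset: "Fq_subspace U \<Longrightarrow> v \<in> U \<Longrightarrow> Fq_span v \<subseteq> U"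
  by (auto simp: Fq_subspace_iff Fq_span_def)

lemma Fp_point_span: "v \<noteq> 0 \<Longrightarrow> Fp_point CHAR('a) (Fp_span (v :: 'n \<Rightarrow> 'a::{field,finite}))"
  unfolding Fp_point_def Fp_span_def
  using Fp_subspace_span[of v] card_image[OF inj_on_subset[OF inj_smul[of v]], of prime_subfield]
  by (simp add: Fp_span_def card_prime_subfield)

lemma spread_elt_span: "v \<noteq> 0 \<Longrightarrow> spread_elt (Fq_span (v :: 'n \<Rightarrow> 'a::{field,finite}))"
  unfolding spread_elt_def Fq_span_def
  using Fq_subspace_span[of v] card_image[OF inj_smul[of v]] by (simp add: Fq_span_def)

lemma Fp_point_eq_span:
  fixes P :: "('n::finite \<Rightarrow> 'a::{field,finite}) set"
  assumes "Fp_point CHAR('a) P" "v \<in> P" "v \<noteq> 0"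
  shows "P = Fp_span v"
  using card_seteq[of P "Fp_span v"] Fp_span_subset[of P v] Fp_point_span[of v] assms
  by (auto simp: Fp_point_def)

lemma spread_elt_eq_span:
  fixes X :: "('n::finite \<Rightarrow> 'a::{field,finite}) set"
  assumes "spread_elt X" "v \<in> X" "v \<noteq> 0"
  shows "X = Fq_span v"
  using card_seteq[of X "Fq_span v"] Fq_span_subset[of X v] spread_elt_span[of v] assms
  by (auto simp: spread_elt_def)

lemma Fp_point_nonzero:
  fixes P :: "('n \<Rightarrow> 'a::{field,finite}) set"
  assumes "Fp_point CHAR('a) P"
  obtains v where "v \<in> P" "v \<noteq> 0"
proof -
  have "card P \<ge> 2"
    using assms prime_CHAR_finite[where ?'a = 'a] prime_ge_2_nat by (auto simp: Fp_point_def)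
  then have "\<not> P \<subseteq> {0}"
    using card_mono[of "{0}" P] by auto
  then show ?thesis using that by auto
qed

text \<open>Additivity alone suffices, because scalars of the prime subfield act as repeated
  addition. The values are kept in \<open>'a\<close> so that they can serve as coordinates in the
  polynomial argument.\<close>

definition Fp_functional :: "(('n \<Rightarrow> 'a::field) \<Rightarrow> 'a) \<Rightarrow> bool" where
  "Fp_functional h \<longleftrightarrow> (\<forall>x y. h (x + y) = h x + h y) \<and> range h \<subseteq> prime_subfield"

lemma
  assumes "Fp_functional h"
  shows Fp_functional_add: "h (x + y) = h x + h y"
    and Fp_functional_mem: "h x \<in> prime_subfield"
    and Fp_functional_0: "h 0 = 0"
    and Fp_functional_diff: "h (x - y) = h x - h y"
    and Fp_functional_smul: "c \<in> prime_subfield \<Longrightarrow> h (smul c x) = c * h x"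
proof -
  show add: "h (x + y) = h x + h y" for x y
    using assms by (simp add: Fp_functional_def)
  show "h x \<in> prime_subfield"
    using assms by (auto simp: Fp_functional_def)
  show h0: "h 0 = 0" using add[of 0 0] by (metis add.right_neutral add_left_cancel)
  show "h (x - y) = h x - h y" using add[of "x - y" y] by simp
  have "h (smul (of_nat k) x) = of_nat k * h x" for k
  proof (induction k)
    case (Suc k)
    have "smul (of_nat (Suc k)) x = smul (of_nat k) x + x"
      by (simp add: smul_add_left add.commute)
    then have "h (smul (of_nat (Suc k)) x) = h (smul (of_nat k) x) + h x"
      by (simp only: add)
    then show ?case
      by (simp only: Suc of_nat_Suc distrib_right mult_1_left add.commute)
  qed (metis h0 mult_zero_left of_nat_0 smul_zero_left)
  then show "h (smul c x) = c * h x" if "c \<in> prime_subfield"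
    using that by (auto simp: prime_subfield_def)
qed

lemma Fp_functional_diff_mult:
  fixes h l :: "('n \<Rightarrow> 'a::{field,finite}) \<Rightarrow> 'a"
  assumes "Fp_functional h" "Fp_functional l" "c \<in> prime_subfield"
  shows "Fp_functional (\<lambda>x. h x - c * l x)"
  using assms by (auto simp: Fp_functional_def algebra_simps image_subset_iff
      intro!: diff_prime_subfield mult_prime_subfield)

text \<open>Let \<open>M\<close> be maximal among the subspaces that contain \<open>K\<close> and
  miss \<open>u\<close>. Then every vector is an element of \<open>M\<close> plus a unique
  prime-subfield multiple of \<open>u\<close>, and that scalar is the functional.\<close>

lemma Fp_functional_separation:
  fixes K :: "('n::finite \<Rightarrow> 'a::{field,finite}) set"
  assumes K: "Fp_subspace K" and u: "u \<notin> K"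
  obtains h where "Fp_functional h" "\<And>x. x \<in> K \<Longrightarrow> h x = 0" "h u = 1"
proof -
  obtain M where M: "Fp_subspace M" "K \<subseteq> M" "u \<notin> M"
    and max: "\<And>M'. Fp_subspace M' \<Longrightarrow> K \<subseteq> M' \<Longrightarrow> u \<notin> M' \<Longrightarrow> M \<subseteq> M' \<Longrightarrow> M = M'"
    using finite_has_maximal2[of "{M. Fp_subspace M \<and> K \<subseteq> M \<and> u \<notin> M}" K] K u by auto
  have unique: "c = c'" if "c \<in> prime_subfield" "c' \<in> prime_subfield"
    "v - smul c u \<in> M" "v - smul c' u \<in> M" for c c' v
  proof (rule ccontr)
    assume "c \<noteq> c'"
    moreover have "smul (c - c') u \<in> M"
      using Fp_subspace_diff[OF M(1) that(4,3)] by (simp add: smul_diff_left)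
    ultimately show False
      using Fp_subspace_smul_cancel[OF M(1) diff_prime_subfield[OF that(1,2)]] M(3) by simp
  qed
  have ex: "\<exists>c\<in>prime_subfield. v - smul c u \<in> M" for v
  proof (cases "v \<in> M")
    case True
    then show ?thesis by (intro bexI[of _ 0]) auto
  next
    case False
    \<comment> \<open>By maximality, enlarging \<open>M\<close> by \<open>v\<close> captures
      \<open>u\<close>; the relation \<open>u = m + smul c v\<close> has \<open>c \<noteq> 0\<close>
      and can be solved for \<open>v\<close>.\<close>
    let ?M = "sumset M (Fp_span v)"
    have "Fp_subspace ?M"
      by (rule Fp_subspace_sumset[OF M(1) Fp_subspace_span])
    moreover have "M \<subseteq> ?M" "v \<in> ?M"
      using sumset_superset[OF M(1) Fp_subspace_span, of v] in_Fp_span[of v] by auto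
    ultimately have "u \<in> ?M" using max[of ?M] M(2) False by blast
    then obtain m c where mc: "u = m + smul c v" "m \<in> M" "c \<in> prime_subfield"
      by (auto simp: sumset_eq Fp_span_def)
    then have "c \<noteq> 0" using M(3) by auto
    have "v - smul (inverse c) u = smul (- inverse c) m"
      using \<open>c \<noteq> 0\<close> by (auto simp: mc(1) smul_def fun_eq_iff field_simps)
    moreover have "smul (- inverse c) m \<in> M"
      using Fp_subspace_smul[OF M(1)] mc inverse_prime_subfield uminus_prime_subfield by metis
    ultimately show ?thesis
      using inverse_prime_subfield mc(3) by metis
  qed
  define h where "h v = (THE c. c \<in> prime_subfield \<and> v - smul c u \<in> M)" for v
  have h: "h v = c" if "c \<in> prime_subfield" "v - smul c u \<in> M" for v c
    unfolding h_def using unique that by blast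
  have hM: "h v \<in> prime_subfield \<and> v - smul (h v) u \<in> M" for v
    using ex[of v] h by blast
  show ?thesis
  proof
    show "h x = 0" if "x \<in> K" for x using that M(2) by (intro h) auto
    show "h u = 1" using Fp_subspace_0[OF M(1)] by (intro h) auto
    have "h (x + y) = h x + h y" for x y
    proof (rule h)
      have "x + y - smul (h x + h y) u = (x - smul (h x) u) + (y - smul (h y) u)"
        by (simp add: smul_add_left)
      then show "x + y - smul (h x + h y) u \<in> M"
        using hM Fp_subspace_add[OF M(1)] by metis
    qed (use hM add_prime_subfield in blast)
    then show "Fp_functional h" using hM by (auto simp: Fp_functional_def)
  qed
qed

text \<open>Pass to a minimal \<open>B \<subseteq> A\<close> with the same property and let the functional \<open>l\<close> vanish at \<open>d\<close>. For
  each \<open>h\<close> the points \<open>(l v, h v)\<close> contain a full vertical line; its abscissa does not depend on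
  \<open>h\<close>, since two such lines need \<open>2 * p\<close> points. So one level set of \<open>l\<close> already has the property,
  and by minimality \<open>l\<close> is constant on \<open>B\<close>.\<close>

lemma blocking_functionals_imp_line:
  fixes A :: "('n::finite \<Rightarrow> 'a::{field,finite}) set"
  assumes card: "2 * card A \<le> 3 * CHAR('a)" and d: "d \<noteq> 0"
    and surj: "\<And>h. Fp_functional h \<Longrightarrow> h d = 1 \<Longrightarrow> prime_subfield \<subseteq> h ` A"
  obtains v where "\<And>c. c \<in> prime_subfield \<Longrightarrow> v + smul c d \<in> A"
proof -
  let ?F = "prime_subfield :: 'a set"
  define Q where "Q B \<longleftrightarrow> (\<forall>h. Fp_functional h \<longrightarrow> h d = 1 \<longrightarrow> ?F \<subseteq> h ` B)" for B
  obtain B where BA: "B \<subseteq> A" and B: "Q B"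
    and min: "\<And>B'. B' \<subseteq> B \<Longrightarrow> Q B' \<Longrightarrow> B' = B"
  proof -
    have "finite {B. B \<subseteq> A \<and> Q B}" "A \<in> {B. B \<subseteq> A \<and> Q B}"
      using surj by (auto simp: Q_def)
    from finite_has_minimal2[OF this] obtain B where "B \<subseteq> A" "Q B"
      and min: "\<forall>B'\<in>{B. B \<subseteq> A \<and> Q B}. B' \<subseteq> B \<longrightarrow> B = B'" by blast
    show thesis
    proof (rule that)
      show "B' = B" if "B' \<subseteq> B" "Q B'" for B'
        using min that \<open>B \<subseteq> A\<close> by auto
    qed fact+
  qed
  have cardB: "2 * card B \<le> 3 * CHAR('a)"
    using card card_mono[OF _ BA] by simp
  obtain h0 where h0: "Fp_functional h0" "h0 d = 1"
  proof (rule Fp_functional_separation[of "{0}" d])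
    show "Fp_subspace {0 :: 'n \<Rightarrow> 'a}" by (auto simp: Fp_subspace_iff)
  qed (use d in auto)
  have const: "l v = l w" if l: "Fp_functional l" "l d = 0" and "v \<in> B" "w \<in> B" for l v w
  proof -
    have ex: "\<exists>c. ?F \<subseteq> h ` {v \<in> B. l v = c}" if h: "Fp_functional h" "h d = 1" for h
    proof -
      let ?S = "(\<lambda>v. (l v, h v)) ` B"
      have "\<exists>c. {c} \<times> ?F \<subseteq> ?S"
      proof (rule redei_line)
        show "2 * card ?S \<le> 3 * CHAR('a)"
          using cardB card_image_le[of B "\<lambda>v. (l v, h v)"] by simp
        show "?S \<subseteq> ?F \<times> ?F"
          using h l Fp_functional_mem by auto
        fix u b :: 'a assume u: "u \<in> ?F" and b: "b \<in> ?F"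
        \<comment> \<open>As \<open>l d = 0\<close>, the functional \<open>h - u * l\<close> still
          takes the value 1 at \<open>d\<close>, so \<open>Q B\<close> applies to every slope
          \<open>u\<close>.\<close>
        have "?F \<subseteq> (\<lambda>x. h x - u * l x) ` B"
          using B Fp_functional_diff_mult[OF h(1) l(1) u] h(2) l(2) by (simp add: Q_def)
        then show "\<exists>v\<in>?S. snd v - u * fst v = b" using b by auto
      qed simp
      then show ?thesis by fastforce
    qed
    have large: "CHAR('a) \<le> card C" if "?F \<subseteq> h ` C" for h :: "('n \<Rightarrow> 'a) \<Rightarrow> 'a" and C
      using card_mono[OF _ that] card_image_le[of C h] by (simp add: card_prime_subfield)
    obtain c0 where c0: "?F \<subseteq> h0 ` {v \<in> B. l v = c0}" using ex h0 by blast
    have "?F \<subseteq> h ` {v \<in> B. l v = c0}" if h: "Fp_functional h" "h d = 1" for h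
    proof -
      obtain c where c: "?F \<subseteq> h ` {v \<in> B. l v = c}" using ex h by blast
      have "c = c0"
      proof (rule ccontr)
        assume "c \<noteq> c0"
        then have "card ({v \<in> B. l v = c} \<union> {v \<in> B. l v = c0})
            = card {v \<in> B. l v = c} + card {v \<in> B. l v = c0}"
          by (intro card_Un_disjoint) auto
        moreover have "card ({v \<in> B. l v = c} \<union> {v \<in> B. l v = c0}) \<le> card B"
          by (intro card_mono) auto
        ultimately have "2 * CHAR('a) \<le> card B"
          using large[OF c] large[OF c0] by linarith
        moreover have "CHAR('a) > 0" by (simp add: finite_imp_CHAR_pos)
        ultimately show False using cardB by linarith
      qed
      then show ?thesis using c by simp
    qed
    then have "Q {v \<in> B. l v = c0}" by (simp add: Q_def)
    then have "{v \<in> B. l v = c0} = B" using min[of "{v \<in> B. l v = c0}"] by blast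
    then have "l x = c0" if "x \<in> B" for x using that by auto
    then show ?thesis using \<open>v \<in> B\<close> \<open>w \<in> B\<close> by simp
  qed
  have "?F \<subseteq> h0 ` B" using B h0 by (simp add: Q_def)
  then obtain v where v: "v \<in> B" using one_prime_subfield by blast
  \<comment> \<open>Functionals vanishing at \<open>d\<close> separate the cosets of
    \<open>Fp_span d\<close>; as all of them are constant on \<open>B\<close>, only one coset
    occurs.\<close>
  have coset: "w - v \<in> Fp_span d" if "w \<in> B" for w
  proof (rule ccontr)
    assume "w - v \<notin> Fp_span d"
    then obtain l where l: "Fp_functional l" "\<And>x. x \<in> Fp_span d \<Longrightarrow> l x = 0" "l (w - v) = 1"
      using Fp_functional_separation[OF Fp_subspace_span[of d]] by metis
    then show False
      using const[of l w v] that v by (simp add: Fp_functional_diff)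
  qed
  show ?thesis
  proof
    fix c :: 'a assume c: "c \<in> ?F"
    \<comment> \<open>On the coset of \<open>v\<close> the functional \<open>h0\<close> is injective
      because \<open>h0 d = 1\<close>, so an element of \<open>B\<close> with value
      \<open>h0 v + c\<close> must be \<open>v + smul c d\<close>.\<close>
    then have "h0 v + c \<in> h0 ` B"
      using \<open>?F \<subseteq> h0 ` B\<close> add_prime_subfield Fp_functional_mem[OF h0(1)] by blast
    then obtain w where w: "w \<in> B" "h0 w = h0 v + c" by auto
    then obtain k where k: "k \<in> ?F" "w - v = smul k d"
      using coset by (auto simp: Fp_span_def)
    then have "k = c"
      using h0 w Fp_functional_diff[OF h0(1), of w v] by (simp add: Fp_functional_smul)
    then have "v + smul c d = w" using k by (metis add_diff_cancel_left' diff_add_cancel add.commute)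
    then show "v + smul c d \<in> A" using w BA by blast
  qed
qed

subsection \<open>Linear sets and the cone\<close>

text \<open>A functional that vanishes on \<open>U\<close> and is 1 at some \<open>u\<close> of
  \<open>U'\<close> outside \<open>U\<close> works: by cardinality \<open>U'\<close> is the direct
  sum of \<open>U\<close> and \<open>Fp_span u\<close>, so nothing else in \<open>U'\<close> is
  killed.\<close>

lemma hyperplane_functional:
  fixes U U' :: "('n::finite \<Rightarrow> 'a::{field,finite}) set"
  assumes U: "Fp_subspace U" and U': "Fp_subspace U'" and "U \<subseteq> U'"
    and card: "card U' = CHAR('a) * card U"
  obtains h where "Fp_functional h" "\<And>x. x \<in> U' \<Longrightarrow> h x = 0 \<longleftrightarrow> x \<in> U"
proof -
  have "card U > 0"
    using Fp_subspace_0[OF U] by (auto simp: card_gt_0_iff)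
  moreover have "CHAR('a) > 1"
    using prime_CHAR_finite prime_gt_1_nat by blast
  ultimately have "card U < card U'" by (simp add: card)
  then obtain u where u: "u \<in> U'" "u \<notin> U"
    using assms(3) by (metis less_irrefl subset_antisym subsetI)
  then have u0: "u \<noteq> 0" using Fp_subspace_0[OF U] by auto
  obtain h where h: "Fp_functional h" "\<And>x. x \<in> U \<Longrightarrow> h x = 0" "h u = 1"
    using Fp_functional_separation[OF U u(2)] by blast
  have "U \<inter> Fp_span u = {0}"
  proof -
    have "c = 0" if "c \<in> prime_subfield" "smul c u \<in> U" for c
      using Fp_subspace_smul_cancel[OF U that(1) _ that(2)] u(2) by blast
    then show ?thesis
      using Fp_subspace_0[OF U] Fp_subspace_0[OF Fp_subspace_span[of u]]
      by (auto simp: Fp_span_def)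
  qed
  then have "card (sumset U (Fp_span u)) = card U'"
    using card_sumset[OF U Fp_subspace_span] Fp_point_span[OF u0]
    by (simp add: card Fp_point_def)
  moreover have "sumset U (Fp_span u) \<subseteq> U'"
    using assms(3) Fp_span_subset[OF U' u(1)] Fp_subspace_add[OF U'] by (auto simp: sumset_eq)
  ultimately have eq: "sumset U (Fp_span u) = U'"
    by (intro card_subset_eq) auto
  have "x \<in> U" if "x \<in> U'" "h x = 0" for x
  proof -
    have "x \<in> sumset U (Fp_span u)" using that(1) eq by simp
    then obtain y c where yc: "x = y + smul c u" "y \<in> U" "c \<in> prime_subfield"
      by (auto simp: sumset_eq Fp_span_def)
    then have "h x = c"
      using h by (simp add: Fp_functional_add Fp_functional_smul)
    then show ?thesis using yc that(2) by simp
  qed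
  then show ?thesis using that h by blast
qed

lemma Fp_subspace_kernel:
  fixes h :: "('n \<Rightarrow> 'a::{field,finite}) \<Rightarrow> 'a"
  shows "Fp_subspace U \<Longrightarrow> Fp_functional h \<Longrightarrow> Fp_subspace {x \<in> U. h x = 0}"
  unfolding Fp_subspace_iff
  by (auto simp: Fp_functional_0 Fp_functional_add Fp_functional_smul)

text \<open>Writing \<open>x\<close> as \<open>(x - smul (h x) d) + smul (h x) d\<close> splits
  \<open>U\<close> into the kernel and \<open>Fp_span d\<close>. Kernels of functionals thereby
  become hyperplanes to which the blocking property applies.\<close>

lemma card_kernel:
  fixes U :: "('n::finite \<Rightarrow> 'a::{field,finite}) set"
  assumes U: "Fp_subspace U" and h: "Fp_functional h" and d: "d \<in> U" "h d = 1"
  shows "card {x \<in> U. h x = 0} * CHAR('a) = card U"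
proof -
  let ?K = "{x \<in> U. h x = 0}"
  have d0: "d \<noteq> 0" using d(2) Fp_functional_0[OF h] by auto
  have K: "Fp_subspace ?K" by (rule Fp_subspace_kernel[OF U h])
  have "?K \<inter> Fp_span d = {0}"
    using Fp_subspace_0[OF K] Fp_subspace_0[OF Fp_subspace_span[of d]] d(2)
    by (auto simp: Fp_span_def Fp_functional_smul[OF h])
  then have "card (sumset ?K (Fp_span d)) = card ?K * CHAR('a)"
    using card_sumset[OF K Fp_subspace_span] Fp_point_span[OF d0] by (simp add: Fp_point_def)
  moreover have "sumset ?K (Fp_span d) = U"
  proof
    show "sumset ?K (Fp_span d) \<subseteq> U"
      using Fp_span_subset[OF U d(1)] Fp_subspace_add[OF U] by (auto simp: sumset_eq)
    show "U \<subseteq> sumset ?K (Fp_span d)"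
    proof
      fix x assume x: "x \<in> U"
      have hx: "h x \<in> prime_subfield" by (rule Fp_functional_mem[OF h])
      have "x - smul (h x) d \<in> ?K"
        using Fp_subspace_diff[OF U x Fp_subspace_smul[OF U hx d(1)]] d(2)
        by (simp add: Fp_functional_diff[OF h] Fp_functional_smul[OF h hx])
      moreover have "smul (h x) d \<in> Fp_span d" using hx by (simp add: Fp_span_def)
      ultimately have "(x - smul (h x) d) + smul (h x) d \<in> sumset ?K (Fp_span d)"
        by (rule sumsetI)
      then show "x \<in> sumset ?K (Fp_span d)" by (simp only: diff_add_cancel)
    qed
  qed
  ultimately show ?thesis by simp
qed

lemma Fq_span_in_calB:
  fixes v :: "'n \<Rightarrow> 'a::{field,finite}"
  assumes "v \<noteq> 0" "Fp_span v \<in> U"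
  shows "Fq_span v \<in> calB U"
proof -
  have "Fp_span v \<subseteq> Fq_span v" by (auto simp: Fp_span_def Fq_span_def)
  then show ?thesis using assms spread_elt_span[OF assms(1)] by (auto simp: calB_def)
qed

text \<open>If \<open>mu\<close> met a hyperplane trivially, their direct sum would have more
  vectors than the whole space.\<close>

lemma blocking_linear_set:
  fixes mu :: "('n::finite \<Rightarrow> 'a::{field,finite}) set"
  assumes mu: "Fp_subspace mu" and card: "card mu > CARD('a)"
  shows "blocking (calB (pts CHAR('a) mu))"
  unfolding blocking_def
proof (intro conjI ballI allI impI)
  fix X assume "X \<in> calB (pts CHAR('a) mu)"
  then show "spread_elt X" by (simp add: calB_def)
next
  fix H :: "('n \<Rightarrow> 'a) set" assume "Fq_hyperplane H"
  then have H: "Fq_subspace H" "card H = CARD('a) ^ (CARD('n) - 1)"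
    by (auto simp: Fq_hyperplane_def)
  have "mu \<inter> H \<noteq> {0}"
  proof
    assume "mu \<inter> H = {0}"
    then have "card mu * card H = card (sumset mu H)"
      by (simp add: card_sumset[OF mu Fq_imp_Fp_subspace[OF H(1)]])
    also have "\<dots> \<le> CARD('n \<Rightarrow> 'a)" by (intro card_mono) auto
    also have "\<dots> = CARD('a) * card H"
      by (simp add: card_fun H(2) flip: power_Suc)
    finally show False using card by (simp add: H(2))
  qed
  then obtain x where x: "x \<in> mu" "x \<in> H" "x \<noteq> 0"
    using Fp_subspace_0[OF mu] Fp_subspace_0[OF Fq_imp_Fp_subspace[OF H(1)]] by blast
  then have "Fp_span x \<in> pts CHAR('a) mu"
    using Fp_point_span Fp_span_subset[OF mu] by (auto simp: pts_def)
  then show "\<exists>X\<in>calB (pts CHAR('a) mu). X \<subseteq> H"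
    using Fq_span_in_calB[OF x(3)] Fq_span_subset[OF H(1) x(2)] by blast
qed

text \<open>Suppose \<open>x = smul c y\<close> with \<open>h x = h y = 1\<close>. Then
  \<open>x - y = smul (c - 1) y\<close> lies in \<open>U\<close>, and \<open>c \<noteq> 1\<close>
  would put \<open>y\<close> itself into \<open>U\<close>. Normalised vectors thus count spread
  elements outside \<open>U\<close>.\<close>

lemma inj_on_Fq_span:
  fixes U U' :: "('n \<Rightarrow> 'a::{field,finite}) set"
  assumes U: "Fq_subspace U" and U': "Fp_subspace U'" and h: "Fp_functional h"
    and ker: "\<And>x. x \<in> U' \<Longrightarrow> h x = 0 \<longleftrightarrow> x \<in> U"
  shows "inj_on Fq_span {x \<in> U'. h x = 1}"
proof (rule inj_onI)
  fix x y assume "x \<in> {x \<in> U'. h x = 1}" "y \<in> {x \<in> U'. h x = 1}" and eq: "Fq_span x = Fq_span y"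
  then have x: "x \<in> U'" "h x = 1" and y: "y \<in> U'" "h y = 1" by auto
  have "x \<in> Fq_span y" using in_Fq_span[of x] eq by blast
  then obtain c where c: "x = smul c y" by (auto simp: Fq_span_def)
  have "h (x - y) = 0" using x y by (simp add: Fp_functional_diff[OF h])
  then have "x - y \<in> U" using ker Fp_subspace_diff[OF U' x(1) y(1)] by blast
  moreover have "x - y = smul (c - 1) y" by (simp add: c smul_diff_left)
  ultimately have "smul (c - 1) y \<in> U" by simp
  moreover have "y \<notin> U" using ker y by force
  ultimately have "c - 1 = 0"
    using U smul_smul[of "inverse (c - 1)" "c - 1" y] unfolding Fq_subspace_iff
    by (metis left_inverse smul_one)
  then show "x = y" using c by simp
qed

theorem theorem5p5:
  fixes p t :: nat
    and Sig Sig' Y Om Gam' :: "('n::finite \<Rightarrow> 'a::{field,finite}) set"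
    and Bb :: "('n \<Rightarrow> 'a) set set"
  assumes "prime p" and "t \<ge> 1" and "CARD('n) \<ge> 2" and "CARD('a) = p ^ t"
    and "Fq_subspace Sig" and "card Sig = CARD('a) ^ (CARD('n) - 1)"
    and "Fp_subspace Sig'" and "card Sig' = p ^ (CARD('n) * t - t + 1)" and "Sig \<subseteq> Sig'"
    and "spread_elt Y" and "Y \<subseteq> Sig"
    and "Fp_subspace Om" and "Om \<subseteq> Y" and "card Om = p ^ (t - 1)"
    and "Fp_subspace Gam'" and "Gam' \<subseteq> Sig'" and "card Gam' = p ^ (CARD('n) * t - 2 * t + 2)"
    and "Gam' \<inter> Om = {vzero}"
    and "Fp_blocking_in p Gam' Bb"
    and "card {P\<in>Bb. P \<subseteq> Gam' \<inter> Sig} = 1"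
    and "\<forall>L. Fp_subspace L \<and> card L = p ^ 2 \<and> Gam' \<inter> Sig \<inter> Y \<subseteq> L \<and> L \<subseteq> Gam'
           \<longrightarrow> (\<exists>P. Fp_point p P \<and> P \<subseteq> L \<and> P \<noteq> Gam' \<inter> Sig \<inter> Y \<and> P \<notin> Bb)"
    and "small (calB (cone p Om Bb))" and "minimal_blocking (calB (cone p Om Bb))"
  shows "Fp_linear p (calB (cone p Om Bb)) \<and> Redei_type (calB (cone p Om Bb))"
proof -
  note Sig = assms(5) and Sig' = assms(7) and Om = assms(12) and Gam' = assms(15)
  let ?F = "prime_subfield :: 'a set"
  let ?B = "calB (cone p Om Bb)"

  \<comment> \<open>Characteristic, cardinalities and the functional that cuts \<open>Sig\<close>
    out of \<open>Sig'\<close>\<close>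
  have p: "p = CHAR('a)" using CHAR_eq_of_card[OF assms(1,4)] by simp
  have p0: "p > 0" using assms(1) prime_gt_0_nat by blast
  have q: "CARD('a) = p * p ^ (t - 1)"
    using assms(2,4) by (cases t) auto
  have SigP: "Fp_subspace Sig" by (rule Fq_imp_Fp_subspace[OF Sig])
  have OmSig: "Om \<subseteq> Sig" using assms(11,13) by blast
  have GO: "Gam' \<inter> Om = {0}" using assms(18) by (simp add: vzero_eq_0)
  have "card Sig' = CHAR('a) * card Sig"
  proof -
    have "CARD('n) * t - t = t * (CARD('n) - 1)"
      by (simp add: algebra_simps diff_mult_distrib2)
    then show ?thesis by (simp add: assms(4,6,8) power_mult flip: p)
  qed
  then obtain f where f: "Fp_functional f" and ker: "\<And>x. x \<in> Sig' \<Longrightarrow> f x = 0 \<longleftrightarrow> x \<in> Sig"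
    using hyperplane_functional[OF SigP Sig' assms(9)] by blast
  have fSig: "f x = 0" if "x \<in> Sig" for x using ker assms(9) that by blast
  note inj = inj_on_Fq_span[OF Sig Sig' f ker]
  have Bb: "Fp_point p P" "P \<subseteq> Gam'" if "P \<in> Bb" for P
    using assms(19) that by (auto simp: Fp_blocking_in_def)
  have meets: "\<exists>P\<in>Bb. P \<subseteq> H"
    if "Fp_subspace H" "H \<subseteq> Gam'" "card H * p = card Gam'" for H
    using assms(19) that by (simp add: Fp_blocking_in_def)

  \<comment> \<open>The point of \<open>Bb\<close> in \<open>Sig\<close> and the affine points of
    \<open>Bb\<close>\<close>
  obtain P where P: "{P\<in>Bb. P \<subseteq> Gam' \<inter> Sig} = {P}"
    using assms(20) by (rule card_1_singletonE)
  have only_P: "Q = P" if "Q \<in> Bb" "Q \<subseteq> Sig" for Q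
  proof -
    have "Q \<in> {P\<in>Bb. P \<subseteq> Gam' \<inter> Sig}" using that Bb(2) by simp
    then show ?thesis unfolding P by simp
  qed
  from P have PB: "P \<in> Bb" "P \<subseteq> Gam'" "P \<subseteq> Sig" by auto
  obtain d where d: "d \<in> P" "d \<noteq> 0"
    using Fp_point_nonzero[of P] Bb(1)[OF PB(1)] p by blast
  then have Pd: "P = Fp_span d"
    using Fp_point_eq_span Bb(1)[OF PB(1)] p by blast
  have dG: "d \<in> Gam'" and dS: "d \<in> Sig" using d PB by auto

  \<comment> \<open>Each point of \<open>Bb\<close> off \<open>Sig\<close> is represented by its
    unique vector with \<open>f v = 1\<close>.\<close>
  define A where "A = {v \<in> Gam'. f v = 1 \<and> Fp_span v \<in> Bb}"
  have surj: "?F \<subseteq> h ` A" if h: "Fp_functional h" "h d = 1" for h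
  proof
    fix b assume b: "b \<in> ?F"
    \<comment> \<open>On \<open>Sig\<close> this agrees with \<open>h\<close>, so it is 1 at
      \<open>d\<close> and its kernel in \<open>Gam'\<close> is a hyperplane missing
      \<open>P\<close>. The point of \<open>Bb\<close> blocking it lies off \<open>Sig\<close>, and
      its normalised vector satisfies \<open>h v = b * f v = b\<close>.\<close>
    define g where "g = (\<lambda>x. h x - b * f x)"
    have g: "Fp_functional g" unfolding g_def by (rule Fp_functional_diff_mult[OF h(1) f b])
    have gd: "g d = 1" using h fSig[OF dS] by (simp add: g_def)
    have "card {x \<in> Gam'. g x = 0} * p = card Gam'"
      using card_kernel[OF Gam' g dG gd] p by simp
    then have "\<exists>Q\<in>Bb. Q \<subseteq> {x \<in> Gam'. g x = 0}"
      by (rule meets[OF Fp_subspace_kernel[OF Gam' g] Collect_restrict])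
    then obtain Q where Q: "Q \<in> Bb" "Q \<subseteq> {x \<in> Gam'. g x = 0}" by (elim bexE)
    then have "Q \<noteq> P" using d(1) gd by auto
    then have "\<not> Q \<subseteq> Sig" using only_P Q(1) by blast
    then obtain w where w: "w \<in> Q" "w \<notin> Sig" by blast
    have "w \<in> Sig'" using w(1) Bb(2)[OF Q(1)] assms(16) by blast
    then have "f w \<noteq> 0" using ker w(2) by blast
    define v where "v = smul (inverse (f w)) w"
    have fw: "inverse (f w) \<in> ?F" by (rule inverse_prime_subfield[OF Fp_functional_mem[OF f]])
    have vQ: "v \<in> Q"
      unfolding v_def using Bb(1)[OF Q(1)] fw w(1)
      by (auto simp: Fp_point_def intro: Fp_subspace_smul)
    have fv: "f v = 1"
      using \<open>f w \<noteq> 0\<close> by (simp add: v_def Fp_functional_smul[OF f fw])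
    then have "v \<noteq> 0" using Fp_functional_0[OF f] by auto
    then have "Q = Fp_span v"
      using Fp_point_eq_span Bb(1)[OF Q(1)] vQ p by blast
    then have "v \<in> A" using Q fv vQ by (auto simp: A_def)
    moreover have "h v = b" using Q(2) vQ fv by (auto simp: g_def)
    ultimately show "b \<in> h ` A" by blast
  qed

  \<comment> \<open>Counting spread elements of the cone and finding the line\<close>
  have in_cone: "Fp_span x \<in> cone p Om Bb" if "Q \<in> Bb" "x \<in> sumset Q Om" "x \<noteq> 0" for x Q
  proof -
    have "Fp_subspace (sumset Q Om)"
      using Fp_subspace_sumset[OF _ Om] Bb(1)[OF that(1)] by (auto simp: Fp_point_def)
    then show ?thesis
      using that Fp_point_span[OF that(3)] Fp_span_subset[of "sumset Q Om" x] p
      by (auto simp: cone_def)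
  qed
  \<comment> \<open>The sums from \<open>A\<close> and \<open>Om\<close> are distinct because
    \<open>Gam'\<close> meets \<open>Om\<close> trivially, and they lie in the affine part
    \<open>f x = 1\<close>, where distinct vectors span distinct spread elements. The extra 1 is the
    element through \<open>P\<close>, inside \<open>Sig\<close>.\<close>
  have "card A * p ^ (t - 1) + 1 \<le> card ?B"
  proof -
    have sub: "A \<times> Om \<subseteq> Gam' \<times> Om" by (auto simp: A_def)
    have "sumset A Om = (\<lambda>(a, b). a + b) ` (A \<times> Om)" by (auto simp: sumset_eq)
    then have cM: "card (sumset A Om) = card A * p ^ (t - 1)"
      using card_image[OF inj_on_subset[OF inj_on_sumset[OF Gam' Om GO] sub]]
      by (simp add: card_cartesian_product assms(14))
    have M: "sumset A Om \<subseteq> {x \<in> Sig'. f x = 1}"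
    proof
      fix x assume "x \<in> sumset A Om"
      then obtain a w where "x = a + w" "a \<in> A" "w \<in> Om" by (auto simp: sumset_eq)
      moreover from this have "f w = 0" "a \<in> Sig'" "w \<in> Sig'" "f a = 1"
        using OmSig fSig assms(9,16) by (auto simp: A_def)
      ultimately show "x \<in> {x \<in> Sig'. f x = 1}"
        using Fp_subspace_add[OF Sig'] by (simp add: Fp_functional_add[OF f])
    qed
    have "Fq_span ` sumset A Om \<subseteq> ?B"
    proof (rule image_subsetI)
      fix x assume x: "x \<in> sumset A Om"
      then have x0: "x \<noteq> 0" using M Fp_functional_0[OF f] by auto
      obtain a w where "x = a + w" "a \<in> A" "w \<in> Om" using x by (auto simp: sumset_eq)
      then have "Fp_span a \<in> Bb" "x \<in> sumset (Fp_span a) Om"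
        by (auto simp: A_def intro: sumsetI)
      then show "Fq_span x \<in> ?B"
        using Fq_span_in_calB[OF x0] in_cone x0 by blast
    qed
    moreover have "Fq_span d \<in> ?B"
      using Fq_span_in_calB[OF d(2)] in_cone[OF PB(1) _ d(2)] d(1)
        sumset_superset(1)[OF _ Om, of P] Fp_subspace_span[of d] Pd by blast
    moreover have "Fq_span d \<notin> Fq_span ` sumset A Om"
    proof
      assume "Fq_span d \<in> Fq_span ` sumset A Om"
      then obtain x where x: "x \<in> sumset A Om" "Fq_span d = Fq_span x" by blast
      then have "x \<in> Sig" using in_Fq_span[of x] Fq_span_subset[OF Sig dS] by blast
      then show False using fSig x(1) M by auto
    qed
    ultimately have "card (insert (Fq_span d) (Fq_span ` sumset A Om)) \<le> card ?B"
      by (intro card_mono) auto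
    then show ?thesis
      using \<open>Fq_span d \<notin> _\<close> card_image[OF inj_on_subset[OF inj M]] by (simp add: cM)
  qed
  moreover have "2 * card ?B < 3 * (p * p ^ (t - 1) + 1)"
    using assms(22) unfolding small_def q .
  \<comment> \<open>The extra element matters here: \<open>2 * x + 2 \<le> 2 * c < 3 * y + 3\<close>
    leaves exactly \<open>2 * x \<le> 3 * y\<close>.\<close>
  moreover have "x + 1 \<le> c \<Longrightarrow> 2 * c < 3 * (y + 1) \<Longrightarrow> 2 * x \<le> 3 * y" for x y c :: nat
    by presburger
  ultimately have "2 * (card A * p ^ (t - 1)) \<le> 3 * (p * p ^ (t - 1))" by blast
  then have "(2 * card A) * p ^ (t - 1) \<le> (3 * p) * p ^ (t - 1)" by (simp only: mult.assoc)
  then have "2 * card A \<le> 3 * p"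
    unfolding mult_le_cancel2 using p0 by simp
  then have "2 * card A \<le> 3 * CHAR('a)" unfolding p .
  then obtain v where v: "\<And>c. c \<in> ?F \<Longrightarrow> v + smul c d \<in> A"
    using blocking_functionals_imp_line[OF _ d(2) surj] by blast
  have "v \<in> A" using v[of 0] by simp
  then have vS: "v \<in> Sig'" and fv: "f v = 1" using assms(16) by (auto simp: A_def)

  \<comment> \<open>The linear set of the span of the line and \<open>Om\<close>\<close>
  define D where "D = sumset (Fp_span d) Om"
  define mu where "mu = sumset (Fp_span v) D"
  have D: "Fp_subspace D"
    unfolding D_def by (rule Fp_subspace_sumset[OF Fp_subspace_span Om])
  have mu: "Fp_subspace mu"
    unfolding mu_def by (rule Fp_subspace_sumset[OF Fp_subspace_span D])
  \<comment> \<open>Since \<open>f v = 1\<close>, this makes \<open>D\<close> the whole intersection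
    of \<open>mu\<close> with \<open>Sig\<close>.\<close>
  have DS: "D \<subseteq> Sig"
    using Fp_span_subset[OF SigP dS] OmSig Fp_subspace_add[OF SigP]
    by (auto simp: D_def sumset_eq)
  have cD: "card D = CARD('a)"
  proof -
    have "Fp_span d \<inter> Om = {0}"
      using GO PB(2) Pd Fp_subspace_0[OF Fp_subspace_span[of d]] by auto
    then show ?thesis
      unfolding D_def using card_sumset[OF Fp_subspace_span Om] Fp_point_span[OF d(2)]
      by (simp add: Fp_point_def assms(14) q p)
  qed
  have cmu: "card mu > CARD('a)"
  proof -
    have "Fp_span v \<inter> D = {0}"
    proof -
      have "x = 0" if x: "x \<in> Fp_span v" "x \<in> D" for x
      proof -
        obtain c where c: "c \<in> ?F" "x = smul c v" using x(1) by (auto simp: Fp_span_def)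
        then have "f x = c" using fv by (simp add: Fp_functional_smul[OF f])
        moreover have "f x = 0" using fSig DS x(2) by blast
        ultimately show ?thesis using c by simp
      qed
      then show ?thesis
        using Fp_subspace_0[OF D] Fp_subspace_0[OF Fp_subspace_span[of v]] by auto
    qed
    moreover have "v \<noteq> 0" using fv Fp_functional_0[OF f] by auto
    ultimately have "card mu = p * CARD('a)"
      unfolding mu_def using card_sumset[OF Fp_subspace_span D] Fp_point_span[of v]
      by (simp add: Fp_point_def cD p)
    then show ?thesis using assms(1) prime_gt_1_nat by simp
  qed
  let ?B' = "calB (pts p mu)"
  have "?B' \<subseteq> ?B"
  proof
    fix X assume "X \<in> ?B'"
    then obtain Q where X: "spread_elt X" and Q: "Fp_point p Q" "Q \<subseteq> mu" "Q \<subseteq> X"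
      by (auto simp: calB_def pts_def)
    obtain x where x: "x \<in> Q" "x \<noteq> 0" using Fp_point_nonzero[of Q] Q(1) p by blast
    have Qx: "Q = Fp_span x" using Fp_point_eq_span Q(1) x p by blast
    have "x \<in> mu" using x Q by blast
    then obtain c k w where x_eq: "x = smul c v + (smul k d + w)"
      and ckw: "c \<in> ?F" "k \<in> ?F" "w \<in> Om"
      by (auto simp: mu_def D_def sumset_eq Fp_span_def)
    \<comment> \<open>If the coefficient \<open>c\<close> of \<open>v\<close> is zero,
      \<open>x\<close> lies in the span of \<open>P\<close> and \<open>Om\<close>. Otherwise
      dividing by \<open>c\<close> exhibits the point \<open>v + smul (inverse c * k) d\<close> of
      the line as the base point.\<close>
    have "\<exists>R\<in>Bb. x \<in> sumset R Om"
    proof (cases "c = 0")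
      case True
      then have "x \<in> sumset P Om"
        using x_eq ckw by (auto simp: Pd Fp_span_def intro!: sumsetI)
      then show ?thesis using PB(1) by blast
    next
      case False
      define a where "a = v + smul (inverse c * k) d"
      have "a \<in> A"
        unfolding a_def by (intro v mult_prime_subfield inverse_prime_subfield ckw)
      moreover have "x = smul c a + w"
        using False by (simp add: x_eq a_def smul_add add.assoc flip: mult.assoc)
      moreover have "smul c a \<in> Fp_span a" using ckw(1) by (simp add: Fp_span_def)
      ultimately show ?thesis
        using ckw(3) by (auto simp: A_def intro!: bexI[of _ "Fp_span a"] sumsetI)
    qed
    then have "Q \<in> cone p Om Bb" using in_cone x(2) Qx by blast
    then show "X \<in> ?B" using X Q(3) by (auto simp: calB_def)
  qed
  moreover have "blocking ?B'"
    unfolding p by (rule blocking_linear_set[OF mu cmu])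
  \<comment> \<open>A blocking subset of a minimal blocking set cannot be proper.\<close>
  ultimately have BB': "?B = ?B'"
    using assms(23) by (auto simp: minimal_blocking_def psubset_eq)

  \<comment> \<open>Redei type, with \<open>Sig\<close> as the witnessing hyperplane\<close>
  have "{X \<in> ?B. \<not> X \<subseteq> Sig} = Fq_span ` ((+) v ` D)"
  proof (intro equalityI subsetI)
    fix X assume "X \<in> {X \<in> ?B. \<not> X \<subseteq> Sig}"
    then obtain Q where X: "spread_elt X" "\<not> X \<subseteq> Sig" and Q: "Fp_point p Q" "Q \<subseteq> mu" "Q \<subseteq> X"
      unfolding BB' by (auto simp: calB_def pts_def)
    obtain x where x: "x \<in> Q" "x \<noteq> 0" using Fp_point_nonzero[of Q] Q(1) p by blast
    have "x \<in> mu" using x Q by blast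
    then obtain c y where x_eq: "x = smul c v + y" and cy: "c \<in> ?F" "y \<in> D"
      by (auto simp: mu_def sumset_eq Fp_span_def)
    have "X = Fq_span x" using spread_elt_eq_span X x Q(3) by blast
    then have "x \<notin> Sig" using Fq_span_subset[OF Sig] X(2) by blast
    then have "c \<noteq> 0" using x_eq cy(2) DS by auto
    \<comment> \<open>Rescaling makes the coefficient of \<open>v\<close> equal to 1, so that
      \<open>z\<close> lies in the coset of \<open>D\<close> through \<open>v\<close>, which has
      exactly \<open>CARD('a)\<close> vectors.\<close>
    define z where "z = smul (inverse c) x"
    have "z \<in> X" using \<open>X = Fq_span x\<close> by (auto simp: z_def Fq_span_def)
    moreover have "z \<noteq> 0" using x(2) \<open>c \<noteq> 0\<close> by (simp add: z_def)
    ultimately have "X = Fq_span z" using spread_elt_eq_span X by blast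
    moreover have "z = v + smul (inverse c) y" using \<open>c \<noteq> 0\<close> by (simp add: z_def x_eq smul_add)
    moreover have "smul (inverse c) y \<in> D"
      using Fp_subspace_smul[OF D] inverse_prime_subfield cy by blast
    ultimately show "X \<in> Fq_span ` ((+) v ` D)" by blast
  next
    fix X assume "X \<in> Fq_span ` ((+) v ` D)"
    then obtain y where y: "y \<in> D" "X = Fq_span (v + y)" by blast
    have "f (v + y) = 1" using fv fSig DS y(1) by (auto simp: Fp_functional_add[OF f])
    then have nS: "v + y \<notin> Sig" and n0: "v + y \<noteq> 0"
      using fSig Fp_functional_0[OF f] by (metis zero_neq_one)+
    have "v + y \<in> mu" unfolding mu_def by (intro sumsetI in_Fp_span y(1))
    then have "Fp_span (v + y) \<in> pts p mu"
      using Fp_point_span[OF n0] Fp_span_subset[OF mu] by (simp add: pts_def p)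
    then have "X \<in> ?B'" using y(2) Fq_span_in_calB[OF n0] by blast
    moreover have "\<not> X \<subseteq> Sig" using nS in_Fq_span[of "v + y"] y(2) by blast
    ultimately show "X \<in> {X \<in> ?B. \<not> X \<subseteq> Sig}" by (simp add: BB')
  qed
  moreover have "card (Fq_span ` ((+) v ` D)) = CARD('a)"
  proof -
    have "(+) v ` D \<subseteq> {x \<in> Sig'. f x = 1}"
      using DS fSig fv vS assms(9) Fp_subspace_add[OF Sig' vS]
      by (auto simp: Fp_functional_add[OF f])
    then show ?thesis
      using card_image[OF inj_on_subset[OF inj]] cD by (simp add: card_image)
  qed
  moreover have "card ?B = card {X \<in> ?B. X \<subseteq> Sig} + card {X \<in> ?B. \<not> X \<subseteq> Sig}"
    by (subst card_Un_disjoint[symmetric]) (auto intro!: arg_cong[of _ _ card])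
  ultimately have "card {X \<in> ?B. X \<subseteq> Sig} + CARD('a) = card ?B" by simp
  then have "Redei_type ?B"
    unfolding Redei_type_def using Sig assms(6) by (auto simp: Fq_hyperplane_def)
  moreover have "Fp_linear p ?B"
    unfolding Fp_linear_def using mu BB' by blast
  ultimately show ?thesis by blast
qed

end
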